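(* Let $K_n=(V,E)$ be the complete graph with $|V|=n\ge 4$. Then the graph of the cone partition for the min-cut problem with non-negative edges, whose vertices are the cones $K^{+}_{\min}(X)$ for all cuts $X$ and whose edges join adjacent cones, has diameter exactly $2$.
   Context: Let $d=\binom{n}{2}=|E|$. For $S\subseteq V$, the cut vector $\mathbf{v}(S)\in\{0,1\}^{d}$ has coordinates indexed by edges $\{i,j\}\in E$, with $\mathbf{v}(S)_{i,j}=1$ if $|S\cap\{i,j\}|=1$ and $0$ otherwise. A cut is a nonempty proper subset $X\subset V$, where $X$ and its complement $V\setminus X$ are identified; the empty cut is excluded, so there are $2^{n-1}-1$ cuts. For a cut $X$, $K^{+}_{\min}(X)=\{\mathbf{c}\in\mathbb{R}^{d}:\ \mathbf{c}\ge\mathbf{0},\ \langle\mathbf{c},\mathbf{v}(X)\rangle\le\langle\mathbf{c},\mathbf{v}(Y)\rangle \text{ for all cuts } Y\}$. Two cones $K^{+}_{\min}(X),K^{+}_{\min}(Y)$ with $X\ne Y$ are adjacent if $\dim\big(K^{+}_{\min}(X)\cap K^{+}_{\min}(Y)\big)=d-1$. The graph of the cone partition has one vertex per cut (the cone $K^{+}_{\min}(X)$) and an edge between two cones iff they are adjacent. *)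

theory Defs
  imports "HOL-Analysis.Analysis" "Graph_Theory.Shortest_Path"
begin

text \<open>The edges of the complete graph on the vertex type \<open>'v\<close>. The class \<open>card2\<close> (at least two
  vertices) is what makes this set of edges nonempty.\<close>

typedef ('v :: card2) edge = "{e :: 'v set. card e = 2}"
proof -
  have "\<exists>e \<subseteq> (UNIV :: 'v set). card e = 2"
    using two_le_card [where 'a = 'v] by (metis obtain_subset_with_card_n)
  then show ?thesis by blast
qed

instance edge :: (card2) finite
proof
  have "(UNIV :: 'a edge set) = Abs_edge ` {e :: 'a set. card e = 2}"
    by (metis type_definition.Abs_image [OF type_definition_edge])
  then show "finite (UNIV :: 'a edge set)" by (metis finite_code finite_imageI)
qed

lemma card_edge: "CARD('v :: card2 edge) = CARD('v) choose 2"
proof -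
  have "CARD('v edge) = card {e :: 'v set. card e = 2}"
    by (rule type_definition.card [OF type_definition_edge])
  also have "\<dots> = CARD('v) choose 2"
    using n_subsets [of "UNIV :: 'v set" 2] by simp
  finally show ?thesis .
qed

definition cut_vector :: "'v :: card2 set \<Rightarrow> real ^ 'v edge" where
  "cut_vector S = (\<chi> e. if card (S \<inter> Rep_edge e) = 1 then 1 else 0)"

definition is_cut :: "'v :: card2 set \<Rightarrow> bool" where
  "is_cut X \<longleftrightarrow> X \<noteq> {} \<and> X \<noteq> UNIV"

definition min_cut_cone :: "'v :: card2 set \<Rightarrow> (real ^ 'v edge) set" where
  "min_cut_cone X =
     {c. (\<forall>e. 0 \<le> c $ e) \<and> (\<forall>Y. is_cut Y \<longrightarrow> c \<bullet> cut_vector X \<le> c \<bullet> cut_vector Y)}"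

lemma cut_vector_Compl: "cut_vector (- S) = cut_vector S"
proof -
  have "card (- S \<inter> Rep_edge e) = 1 \<longleftrightarrow> card (S \<inter> Rep_edge e) = 1" for e
  proof -
    have "card (Rep_edge e) = 2" using Rep_edge [of e] by simp
    moreover have "card (Rep_edge e) = card (S \<inter> Rep_edge e) + card (- S \<inter> Rep_edge e)"
      by (subst card_Un_disjoint [symmetric]) (auto intro: arg_cong [where f = card])
    ultimately show ?thesis by linarith
  qed
  then show ?thesis by (simp add: cut_vector_def)
qed

lemma min_cut_cone_Compl: "min_cut_cone (- X) = min_cut_cone X"
  by (simp add: min_cut_cone_def cut_vector_Compl)

text \<open>Cuts up to complementation, each represented by the class \<open>{X, V - X}\<close>.\<close>

definition cuts :: "'v :: card2 set set set" where
  "cuts = {{X, - X} |X. is_cut X}"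

lemma card_cuts: "card (cuts :: 'v :: card2 set set set) = 2 ^ (CARD('v) - 1) - 1"
proof -
  have U: "\<Union> (cuts :: 'v set set set) = UNIV - {{}, UNIV}"
    by (auto simp: cuts_def is_cut_def)
  have ne: "X \<noteq> - X" for X :: "'v set" by blast
  have "2 * card (cuts :: 'v set set set) = card (\<Union> (cuts :: 'v set set set))"
  proof (rule card_partition)
    show "card c = 2" if "c \<in> cuts" for c :: "'v set set"
      using that ne by (auto simp: cuts_def)
    show "c1 \<inter> c2 = {}" if "c1 \<in> cuts" "c2 \<in> cuts" "c1 \<noteq> c2" for c1 c2 :: "'v set set"
      using that by (auto simp: cuts_def)
  qed simp_all
  also have "\<dots> = 2 ^ CARD('v) - 2"
    unfolding U by (subst card_Diff_subset) (auto simp: card_UNIV_set)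
  also have "\<dots> = 2 * (2 ^ (CARD('v) - 1) - 1)"
    by (cases "CARD('v)") auto
  finally show ?thesis by simp
qed

text \<open>The common value of \<^const>\<open>min_cut_cone\<close> on the two representatives of a cut.\<close>

definition cone_of_cut :: "'v :: card2 set set \<Rightarrow> (real ^ 'v edge) set" where
  "cone_of_cut C = the_elem (min_cut_cone ` C)"

lemma cone_of_cut: "cone_of_cut {X, - X} = min_cut_cone X"
  by (simp add: cone_of_cut_def min_cut_cone_Compl)

definition adjacent_cuts :: "'v :: card2 set set \<Rightarrow> 'v set set \<Rightarrow> bool" where
  "adjacent_cuts C D \<longleftrightarrow>
     C \<noteq> D \<and> aff_dim (cone_of_cut C \<inter> cone_of_cut D) = int (CARD('v) choose 2) - 1"

text \<open>An undirected graph is a symmetric digraph, each edge being a pair of opposite arcs.\<close>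

definition cone_graph :: "('v :: card2 set set, 'v set set \<times> 'v set set) pre_digraph" where
  "cone_graph =
     \<lparr>verts = cuts, arcs = {(C, D). C \<in> cuts \<and> D \<in> cuts \<and> adjacent_cuts C D},
      tail = fst, head = snd\<rparr>"

lemma graph_cone_graph: "graph (cone_graph :: ('v :: card2 set set, _) pre_digraph)"
  by unfold_locales
     (auto simp: cone_graph_def adjacent_cuts_def arc_to_ends_def symmetric_def arcs_ends_def
       sym_def Int_commute image_iff)

text \<open>Distance is the least number of arcs on a walk, so a disconnected graph has diameter \<open>\<infinity>\<close>.\<close>

definition graph_diameter :: "('a, 'b) pre_digraph \<Rightarrow> ereal" where
  "graph_diameter G = (SUP u \<in> verts G. SUP v \<in> verts G. wf_digraph.\<mu> G (\<lambda>_. 1) u v)"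

end

theory Submission
  imports Defs
begin

text \<open>Two distinct cuts have adjacent cones exactly when they do not cross, i.e. when a side \<open>P\<close> of
  one is disjoint from a side \<open>Q\<close> of the other. In that case let \<open>R\<close> be the rest of the vertices and
  distribute weight 2 over the edges between \<open>P\<close> and \<open>R\<close>, weight 2 over those between \<open>Q\<close> and \<open>R\<close>,
  and weight 1 over those between \<open>P\<close> and \<open>Q\<close>, giving each remaining edge weight 4: then \<open>P\<close> and
  \<open>Q\<close> have value 3 and every other cut has value at least 4, so the common face of the two cones
  contains a nonempty open subset of a hyperplane. If \<open>X\<close> and \<open>Y\<close> cross, submodularity makes all
  edges between \<open>X - Y\<close> and \<open>Y - X\<close>, and all edges between \<open>X \<inter> Y\<close> and the complement of
  \<open>X \<union> Y\<close>, vanish on the common face, which thus has codimension at least 2. Crossing cuts exist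
  once there are four vertices, and \<open>X \<inter> Y\<close> crosses neither \<open>X\<close> nor \<open>Y\<close>.\<close>

subsection \<open>Digraphs of diameter two\<close>

lemma (in wf_digraph) awalk_cost_unit: "awalk_cost (\<lambda>_. 1) p = length p"
  by (induction p) simp_all

lemma (in wf_digraph) unit_distance_le_length:
  assumes "awalk u p v"
  shows "\<mu> (\<lambda>_. 1) u v \<le> length p"
  using min_cost_le_walk_cost [OF assms, of "\<lambda>_. 1"] by (simp add: awalk_cost_unit)

lemma (in wf_digraph) length_le_unit_distance:
  assumes "\<And>p. awalk u p v \<Longrightarrow> k \<le> length p"
  shows "k \<le> \<mu> (\<lambda>_. 1) u v"
  unfolding \<mu>_def awalk_cost_unit using assms by (auto intro: INF_greatest)

lemma (in wf_digraph) graph_diameter_le: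
  assumes "\<And>u v. \<lbrakk>u \<in> verts G; v \<in> verts G\<rbrakk> \<Longrightarrow> \<exists>p. awalk u p v \<and> length p \<le> k"
  shows "graph_diameter G \<le> k"
  unfolding graph_diameter_def
proof (intro SUP_least)
  fix u v assume "u \<in> verts G" "v \<in> verts G"
  then obtain p where "awalk u p v" "length p \<le> k" using assms by blast
  then have "\<mu> (\<lambda>_. 1) u v \<le> ereal (length p)" "ereal (length p) \<le> k"
    using unit_distance_le_length by auto
  then show "\<mu> (\<lambda>_. 1) u v \<le> k" by (rule order_trans)
qed

lemma (in wf_digraph) graph_diameter_ge:
  assumes "u \<in> verts G" "v \<in> verts G" "\<And>p. awalk u p v \<Longrightarrow> k \<le> length p"
  shows "k \<le> graph_diameter G"
  unfolding graph_diameter_def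
  using assms by (intro SUP_upper2 [of u] SUP_upper2 [of v] length_le_unit_distance)

lemma (in wf_digraph) graph_diameter_le_2I:
  assumes "\<And>u v. \<lbrakk>u \<in> verts G; v \<in> verts G; u \<noteq> v; \<not> u \<rightarrow> v\<rbrakk> \<Longrightarrow> \<exists>w. u \<rightarrow> w \<and> w \<rightarrow> v"
  shows "graph_diameter G \<le> 2"
proof -
  have "\<exists>p. awalk u p v \<and> length p \<le> 2" if uv: "u \<in> verts G" "v \<in> verts G" for u v
  proof -
    consider (equal) "u = v" | (arc) "u \<rightarrow> v" | (arcs) w where "u \<rightarrow> w" "w \<rightarrow> v"
      using assms uv by blast
    then show ?thesis
    proof cases
      case equal
      then have "awalk u [] v" using uv by (simp add: awalk_Nil_iff)
      then show ?thesis by force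
    next
      case arc
      then obtain a where "awalk u [a] v" by (metis arc_implies_awalk reachableE)
      then show ?thesis by force
    next
      case arcs
      then obtain a b where "awalk u [a] w" "awalk w [b] v"
        by (metis arc_implies_awalk reachableE)
      then have "awalk u [a, b] v" by (auto simp: awalk_simps)
      then show ?thesis by force
    qed
  qed
  then show ?thesis using graph_diameter_le [of 2] by simp
qed

lemma (in wf_digraph) graph_diameter_ge_2I:
  assumes "u \<in> verts G" "v \<in> verts G" "u \<noteq> v" "\<not> u \<rightarrow> v"
  shows "2 \<le> graph_diameter G"
proof -
  have "2 \<le> length p" if "awalk u p v" for p
  proof -
    have "length p \<noteq> 0" "length p \<noteq> 1"
      using that assms by (auto simp: length_Suc_conv awalk_simps arcs_ends_conv)
    then show ?thesis by linarith
  qed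
  then show ?thesis using graph_diameter_ge [of u v 2] assms by simp
qed

subsection \<open>Affine dimension\<close>

lemma aff_dim_eq_convex_Int_open:
  fixes H :: "'a::euclidean_space set"
  assumes "convex H" "open U" "H \<inter> U \<noteq> {}" "H \<inter> U \<subseteq> S" "S \<subseteq> H"
  shows "aff_dim S = aff_dim H"
proof (rule antisym)
  show "aff_dim S \<le> aff_dim H"
    using assms(5) by (rule aff_dim_subset)
  have "aff_dim H = aff_dim (H \<inter> U)"
    using assms(1-3) by (simp add: aff_dim_convex_Int_open)
  also have "\<dots> \<le> aff_dim S"
    using assms(4) by (rule aff_dim_subset)
  finally show "aff_dim H \<le> aff_dim S" .
qed

lemma hyperplane_inner_eq: "{x. x \<bullet> u = x \<bullet> v} = {x. (u - v) \<bullet> x = 0}"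
  for u v :: "'a::real_inner"
  by (simp add: inner_diff_left inner_commute [of u] inner_commute [of v])

lemma aff_dim_inner_eq:
  fixes u v :: "'a::euclidean_space"
  assumes "u \<noteq> v"
  shows "aff_dim {x. x \<bullet> u = x \<bullet> v} = int DIM('a) - 1"
  using assms by (simp add: hyperplane_inner_eq Suc_leI)

lemma aff_dim_coordinates_zero:
  "aff_dim {x :: real ^ 'n. \<forall>i\<in>I. x $ i = 0} = int CARD('n) - int (card I)"
proof -
  let ?S = "{x :: real ^ 'n. \<forall>i\<in>I. x $ i = 0}"
  have "subspace ?S" by (simp add: subspace_def)
  then have "aff_dim ?S = int (dim ?S)" by (rule aff_dim_subspace)
  also have "dim ?S = card (- I)"
    using dim_substandard_cart [of "- I", where 'a = real] by (simp add: dim_vec_eq Ball_def)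
  also have "int (card (- I)) = int CARD('n) - int (card I)"
    by (simp add: Compl_eq_Diff_UNIV card_Diff_subset of_nat_diff card_mono)
  finally show ?thesis .
qed

subsection \<open>Edges between vertex sets and incidence vectors\<close>

lemma Rep_edge_cases:
  obtains a b where "a \<noteq> b" "Rep_edge e = {a, b}"
  using Rep_edge [of e] by (auto simp: card_2_iff)

lemma Rep_Abs_edge: "a \<noteq> b \<Longrightarrow> Rep_edge (Abs_edge {a, b}) = {a, b}"
  by (simp add: Abs_edge_inverse)

definition edges_between :: "'v :: card2 set \<Rightarrow> 'v set \<Rightarrow> 'v edge set" where
  "edges_between S T = {e. \<exists>a\<in>S. \<exists>b\<in>T. Rep_edge e = {a, b}}"

lemma mem_edges_between_iff:
  assumes "Rep_edge e = {a, b}"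
  shows "e \<in> edges_between S T \<longleftrightarrow> a \<in> S \<and> b \<in> T \<or> a \<in> T \<and> b \<in> S"
  by (auto simp: edges_between_def assms doubleton_eq_iff)

lemma edges_between_commute: "edges_between S T = edges_between T S"
proof -
  have "e \<in> edges_between S T \<longleftrightarrow> e \<in> edges_between T S" for e
    by (cases e rule: Rep_edge_cases) (auto simp: mem_edges_between_iff)
  then show ?thesis by blast
qed

lemma edges_between_mono: "\<lbrakk>S \<subseteq> S'; T \<subseteq> T'\<rbrakk> \<Longrightarrow> edges_between S T \<subseteq> edges_between S' T'"
  unfolding edges_between_def by blast

lemma edges_between_Un: "edges_between S (T \<union> U) = edges_between S T \<union> edges_between S U"
  unfolding edges_between_def by blast

lemma edges_between_disjoint:
  assumes "S \<inter> U = {}" "T \<inter> U = {}"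
  shows "edges_between S T \<inter> edges_between R U = {}"
proof -
  have False if "e \<in> edges_between S T" "e \<in> edges_between R U" for e
    using that assms by (cases e rule: Rep_edge_cases) (auto simp: mem_edges_between_iff)
  then show ?thesis by blast
qed

lemma edges_between_nonempty:
  assumes "S \<inter> T = {}" "S \<noteq> {}" "T \<noteq> {}"
  shows "edges_between S T \<noteq> {}"
proof -
  obtain a b where "a \<in> S" "b \<in> T" using assms by blast
  moreover from this assms have "a \<noteq> b" by blast
  ultimately show ?thesis unfolding edges_between_def using Rep_Abs_edge by blast
qed

definition incidence_vector :: "'n set \<Rightarrow> real ^ 'n" where
  "incidence_vector F = (\<chi> i. if i \<in> F then 1 else 0)"

lemma inner_incidence_vector: "c \<bullet> incidence_vector F = (\<Sum>i\<in>F. c $ i)"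
proof -
  have "c \<bullet> incidence_vector F = (\<Sum>i\<in>UNIV. if i \<in> F then c $ i else 0)"
    unfolding inner_vec_def incidence_vector_def by (intro sum.cong) auto
  then show ?thesis by (simp add: sum.If_cases)
qed

lemma incidence_vector_Un:
  "F \<inter> F' = {} \<Longrightarrow> incidence_vector (F \<union> F') = incidence_vector F + incidence_vector F'"
  by (auto simp: incidence_vector_def vec_eq_iff)

lemma cut_vector_eq_incidence_vector: "cut_vector S = incidence_vector (edges_between S (- S))"
proof -
  have "card (S \<inter> Rep_edge e) = 1 \<longleftrightarrow> e \<in> edges_between S (- S)" for e
    by (cases e rule: Rep_edge_cases) (auto simp: mem_edges_between_iff Int_insert_right)
  then show ?thesis by (simp add: cut_vector_def incidence_vector_def)
qed

lemma cut_vector_eq_add_incidence_vector: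
  assumes "- S = T \<union> U" "T \<inter> U = {}"
  shows "cut_vector S = incidence_vector (edges_between S T) + incidence_vector (edges_between S U)"
proof -
  have "edges_between S T \<inter> edges_between S U = {}"
    using assms by (intro edges_between_disjoint) blast+
  then show ?thesis
    by (simp add: cut_vector_eq_incidence_vector assms(1) edges_between_Un incidence_vector_Un)
qed

lemma cut_vector_add_eq_Int_Un:
  "cut_vector X + cut_vector Y =
    cut_vector (X \<inter> Y) + cut_vector (X \<union> Y)
      + 2 *\<^sub>R incidence_vector (edges_between (X - Y) (Y - X))"
proof -
  have "(cut_vector X + cut_vector Y) $ e =
      (cut_vector (X \<inter> Y) + cut_vector (X \<union> Y)
        + 2 *\<^sub>R incidence_vector (edges_between (X - Y) (Y - X))) $ e" for e
    by (cases e rule: Rep_edge_cases)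
      (auto simp: cut_vector_eq_incidence_vector incidence_vector_def mem_edges_between_iff)
  then show ?thesis by (simp add: vec_eq_iff)
qed

lemma cut_vector_eq_iff: "cut_vector X = cut_vector Y \<longleftrightarrow> X = Y \<or> X = - Y"
proof
  assume eq: "cut_vector X = cut_vector Y"
  have "(a \<in> X \<longleftrightarrow> b \<in> X) \<longleftrightarrow> (a \<in> Y \<longleftrightarrow> b \<in> Y)" for a b
  proof (cases "a = b")
    case False
    then have "cut_vector S $ Abs_edge {a, b} = 1 \<longleftrightarrow> (a \<in> S) \<noteq> (b \<in> S)" for S
      by (auto simp: cut_vector_eq_incidence_vector incidence_vector_def
          mem_edges_between_iff [OF Rep_Abs_edge])
    then show ?thesis using eq by metis
  qed simp
  then show "X = Y \<or> X = - Y" by blast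
qed (auto simp: cut_vector_Compl)

lemma edge_weight_le_inner_cut_vector:
  assumes "\<And>e. 0 \<le> c $ e" "e \<in> edges_between S (- S)"
  shows "c $ e \<le> c \<bullet> cut_vector S"
  unfolding cut_vector_eq_incidence_vector inner_incidence_vector
  using assms by (intro member_le_sum) auto

subsection \<open>Cuts with disjoint sides\<close>

lemma min_cut_cone_inner_le:
  "\<lbrakk>c \<in> min_cut_cone X; is_cut Y\<rbrakk> \<Longrightarrow> c \<bullet> cut_vector X \<le> c \<bullet> cut_vector Y"
  by (simp add: min_cut_cone_def)

definition exactly_two_min_cuts :: "real ^ 'v :: card2 edge \<Rightarrow> 'v set \<Rightarrow> 'v set \<Rightarrow> bool" where
  "exactly_two_min_cuts c P Q \<longleftrightarrow> c \<bullet> cut_vector P = c \<bullet> cut_vector Q \<and>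
    (\<forall>Z. is_cut Z \<and> cut_vector Z \<notin> {cut_vector P, cut_vector Q}
      \<longrightarrow> c \<bullet> cut_vector P < c \<bullet> cut_vector Z)"

lemma aff_dim_Int_min_cut_cones:
  fixes c :: "real ^ 'v :: card2 edge"
  assumes cuts: "is_cut P" "is_cut Q" and neq: "cut_vector P \<noteq> cut_vector Q"
    and pos: "\<And>e. 0 < c $ e" and two_min: "exactly_two_min_cuts c P Q"
  shows "aff_dim (min_cut_cone P \<inter> min_cut_cone Q) = int (CARD('v) choose 2) - 1"
proof -
  define H :: "(real ^ 'v edge) set" where "H = {x. x \<bullet> cut_vector P = x \<bullet> cut_vector Q}"
  define U :: "(real ^ 'v edge) set" where "U = (\<Inter>e. {x. 0 < x $ e}) \<inter>
    (\<Inter>Z\<in>{Z. is_cut Z \<and> cut_vector Z \<notin> {cut_vector P, cut_vector Q}}.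
      {x. x \<bullet> cut_vector P < x \<bullet> cut_vector Z})"
  have "aff_dim (min_cut_cone P \<inter> min_cut_cone Q) = aff_dim H"
  proof (rule aff_dim_eq_convex_Int_open)
    show "convex H"
      unfolding H_def hyperplane_inner_eq by (rule convex_hyperplane)
    show "open U"
      unfolding U_def
      by (intro open_Int open_INT ballI open_Collect_less continuous_intros finite)
    have "c \<in> H \<inter> U" using pos two_min by (auto simp: H_def U_def exactly_two_min_cuts_def)
    then show "H \<inter> U \<noteq> {}" by blast
    show "min_cut_cone P \<inter> min_cut_cone Q \<subseteq> H"
      using cuts by (auto simp: H_def intro!: antisym min_cut_cone_inner_le)
    show "H \<inter> U \<subseteq> min_cut_cone P \<inter> min_cut_cone Q"
    proof
      fix x assume x: "x \<in> H \<inter> U"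
      then have "x \<bullet> cut_vector P \<le> x \<bullet> cut_vector Z" if "is_cut Z" for Z
        using that by (cases "cut_vector Z \<in> {cut_vector P, cut_vector Q}")
          (auto simp: H_def U_def less_imp_le)
      moreover have "0 \<le> x $ e" for e
        using x by (auto simp: U_def less_imp_le)
      ultimately show "x \<in> min_cut_cone P \<inter> min_cut_cone Q"
        using x by (auto simp: H_def min_cut_cone_def)
    qed
  qed
  also have "aff_dim H = int (CARD('v) choose 2) - 1"
    using aff_dim_inner_eq [OF neq] by (simp add: H_def card_edge)
  finally show ?thesis .
qed

lemma exists_pos_function_sum_eq_on_disjoint:
  fixes w :: "'a set \<Rightarrow> real"
  assumes disj: "disjoint \<F>" and fin: "\<And>F. F \<in> \<F> \<Longrightarrow> finite F \<and> F \<noteq> {}"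
    and w: "\<And>F. F \<in> \<F> \<Longrightarrow> 0 < w F" and "0 < m"
  obtains f where "\<And>x. 0 < f x" "\<And>F. F \<in> \<F> \<Longrightarrow> sum f F = w F" "\<And>x. x \<notin> \<Union>\<F> \<Longrightarrow> f x = m"
proof -
  define block where "block x = (THE F. F \<in> \<F> \<and> x \<in> F)" for x
  have block: "block x = F" if "F \<in> \<F>" "x \<in> F" for x F
    unfolding block_def using that disj by (intro the_equality) (auto simp: disjoint_def)
  define f where "f x = (if x \<in> \<Union>\<F> then w (block x) / card (block x) else m)" for x
  show thesis
  proof
    show "0 < f x" for x
      using fin w \<open>0 < m\<close> by (auto simp: f_def block card_gt_0_iff)
    show "sum f F = w F" if "F \<in> \<F>" for F
    proof -
      have "sum f F = (\<Sum>x\<in>F. w F / card F)"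
        using that by (intro sum.cong) (auto simp: f_def block)
      then show ?thesis using fin [OF that] by simp
    qed
    show "f x = m" if "x \<notin> \<Union>\<F>" for x
      using that by (auto simp: f_def)
  qed
qed

lemma cut_vector_cases_tripartition:
  assumes "is_cut Z" and part: "P \<union> Q \<union> R = UNIV" "P \<inter> Q = {}" "P \<inter> R = {}" "Q \<inter> R = {}"
    and unsplit: "\<And>S. S \<in> {P, Q, R} \<Longrightarrow> S \<subseteq> Z \<or> S \<subseteq> - Z"
  shows "cut_vector Z \<in> {cut_vector P, cut_vector Q, cut_vector R}"
proof -
  have "Z \<noteq> {}" "Z \<noteq> UNIV" using \<open>is_cut Z\<close> by (simp_all add: is_cut_def)
  moreover have "P \<subseteq> Z \<or> P \<subseteq> - Z" "Q \<subseteq> Z \<or> Q \<subseteq> - Z" "R \<subseteq> Z \<or> R \<subseteq> - Z"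
    using unsplit by simp_all
  moreover have
    "\<lbrakk>P \<subseteq> Z; Q \<subseteq> Z; R \<subseteq> Z\<rbrakk> \<Longrightarrow> Z = UNIV" "\<lbrakk>P \<subseteq> - Z; Q \<subseteq> - Z; R \<subseteq> - Z\<rbrakk> \<Longrightarrow> Z = {}"
    "\<lbrakk>P \<subseteq> Z; Q \<subseteq> Z; R \<subseteq> - Z\<rbrakk> \<Longrightarrow> Z = - R" "\<lbrakk>P \<subseteq> - Z; Q \<subseteq> - Z; R \<subseteq> Z\<rbrakk> \<Longrightarrow> Z = R"
    "\<lbrakk>P \<subseteq> Z; Q \<subseteq> - Z; R \<subseteq> Z\<rbrakk> \<Longrightarrow> Z = - Q" "\<lbrakk>P \<subseteq> - Z; Q \<subseteq> Z; R \<subseteq> - Z\<rbrakk> \<Longrightarrow> Z = Q"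
    "\<lbrakk>P \<subseteq> - Z; Q \<subseteq> Z; R \<subseteq> Z\<rbrakk> \<Longrightarrow> Z = - P" "\<lbrakk>P \<subseteq> Z; Q \<subseteq> - Z; R \<subseteq> - Z\<rbrakk> \<Longrightarrow> Z = P"
    using part by blast+
  ultimately have "(Z = P \<or> Z = - P) \<or> (Z = Q \<or> Z = - Q) \<or> (Z = R \<or> Z = - R)"
    by argo
  then show ?thesis unfolding cut_vector_eq_iff [symmetric] by simp
qed

lemma exists_tripartition_weights:
  fixes P Q R :: "'v :: card2 set"
  assumes nonempty: "P \<noteq> {}" "Q \<noteq> {}" "R \<noteq> {}"
    and disj: "P \<inter> Q = {}" "P \<inter> R = {}" "Q \<inter> R = {}"
    and weights: "0 < p" "0 < q" "0 < r" and "0 < m"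
  obtains c :: "real ^ 'v edge" where "\<And>e. 0 < c $ e"
    "c \<bullet> incidence_vector (edges_between Q R) = p"
    "c \<bullet> incidence_vector (edges_between P R) = q"
    "c \<bullet> incidence_vector (edges_between P Q) = r"
    "\<And>S e. \<lbrakk>S \<in> {P, Q, R}; e \<in> edges_between S S\<rbrakk> \<Longrightarrow> c $ e = m"
proof -
  let ?A = "edges_between Q R" and ?B = "edges_between P R" and ?C = "edges_between P Q"
  have blocks_disj: "?A \<inter> ?B = {}" "?A \<inter> ?C = {}" "?B \<inter> ?C = {}"
    using edges_between_disjoint [of Q P R R] edges_between_disjoint [of Q P R Q]
      edges_between_disjoint [of P Q R P] disj
    by (simp_all add: Int_commute edges_between_commute)
  have blocks_nonempty: "?A \<noteq> {}" "?B \<noteq> {}" "?C \<noteq> {}"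
    using nonempty disj by (simp_all add: edges_between_nonempty)
  with blocks_disj have blocks_neq: "?A \<noteq> ?B" "?A \<noteq> ?C" "?B \<noteq> ?C" by auto
  define \<F> where "\<F> = {?A, ?B, ?C}"
  define w where "w = (\<lambda>_. r)(?A := p, ?B := q)"
  have "disjoint \<F>"
    using blocks_disj by (auto simp: \<F>_def pairwise_insert disjnt_def Int_commute)
  moreover have "finite F \<and> F \<noteq> {}" "0 < w F" if "F \<in> \<F>" for F
    using that blocks_nonempty weights by (auto simp: \<F>_def w_def)
  ultimately obtain f where f: "\<And>e. 0 < f e" "\<And>F. F \<in> \<F> \<Longrightarrow> sum f F = w F"
    "\<And>e. e \<notin> \<Union>\<F> \<Longrightarrow> f e = m"
    using exists_pos_function_sum_eq_on_disjoint [of \<F> w m] \<open>0 < m\<close> by metis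
  define c :: "real ^ 'v edge" where "c = (\<chi> e. f e)"
  have "c \<bullet> incidence_vector F = w F" if "F \<in> \<F>" for F
    using that f(2) by (simp add: c_def inner_incidence_vector)
  moreover have "c $ e = m" if "S \<in> {P, Q, R}" "e \<in> edges_between S S" for S e
  proof -
    have "e \<notin> \<Union>\<F>"
      using that disj
      by (cases e rule: Rep_edge_cases) (auto simp: \<F>_def mem_edges_between_iff)
    then show ?thesis by (simp add: c_def f(3))
  qed
  ultimately show thesis
    using f(1) blocks_neq by (intro that [of c]) (auto simp: c_def \<F>_def w_def)
qed

lemma exists_weights_exactly_two_min_cuts:
  fixes P Q :: "'v :: card2 set"
  assumes PQ: "P \<noteq> {}" "Q \<noteq> {}" "P \<inter> Q = {}" "P \<union> Q \<noteq> UNIV"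
  obtains c :: "real ^ 'v edge" where "\<And>e. 0 < c $ e" "exactly_two_min_cuts c P Q"
proof -
  define R where "R = - (P \<union> Q)"
  have R: "R \<noteq> {}" "P \<inter> R = {}" "Q \<inter> R = {}" "P \<union> Q \<union> R = UNIV"
    and Compl: "- P = Q \<union> R" "- Q = P \<union> R" "- R = P \<union> Q"
    using PQ by (auto simp: R_def)
  obtain c :: "real ^ 'v edge" where pos: "\<And>e. 0 < c $ e"
    and between: "c \<bullet> incidence_vector (edges_between Q R) = 2"
      "c \<bullet> incidence_vector (edges_between P R) = 2"
      "c \<bullet> incidence_vector (edges_between P Q) = 1"
    and within: "\<And>S e. \<lbrakk>S \<in> {P, Q, R}; e \<in> edges_between S S\<rbrakk> \<Longrightarrow> c $ e = 4"
    using exists_tripartition_weights [of P Q R 2 2 1 4] PQ R by auto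
  have cut_values: "c \<bullet> cut_vector P = 3" "c \<bullet> cut_vector Q = 3" "c \<bullet> cut_vector R = 4"
    using between PQ R by (simp_all add: cut_vector_eq_add_incidence_vector [OF Compl(1)]
        cut_vector_eq_add_incidence_vector [OF Compl(2)]
        cut_vector_eq_add_incidence_vector [OF Compl(3)] inner_add_right edges_between_commute)
  have "4 \<le> c \<bullet> cut_vector Z"
    if Z: "is_cut Z" "cut_vector Z \<notin> {cut_vector P, cut_vector Q}" for Z
  proof (cases "\<forall>S\<in>{P, Q, R}. S \<subseteq> Z \<or> S \<subseteq> - Z")
    case True
    then have "cut_vector Z \<in> {cut_vector P, cut_vector Q, cut_vector R}"
      using Z(1) R(4) PQ(3) R(2,3) by (intro cut_vector_cases_tripartition) blast+
    then show ?thesis using Z(2) cut_values by auto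
  next
    case False
    then obtain S where S: "S \<in> {P, Q, R}" "S \<inter> Z \<noteq> {}" "S - Z \<noteq> {}" by blast
    then obtain e where e: "e \<in> edges_between (S \<inter> Z) (S - Z)"
      using edges_between_nonempty [of "S \<inter> Z" "S - Z"] by blast
    have "e \<in> edges_between S S" "e \<in> edges_between Z (- Z)"
      using e by (auto intro: subsetD [OF edges_between_mono, rotated 2])
    then show ?thesis
      using within S(1) edge_weight_le_inner_cut_vector [of c e Z] pos by (metis less_imp_le)
  qed
  then have "exactly_two_min_cuts c P Q"
    using cut_values by (force simp: exactly_two_min_cuts_def)
  with pos show thesis by (rule that)
qed

lemma cut_pair_eq_iff: "{X, - X} = {Y, - Y} \<longleftrightarrow> X = Y \<or> X = - Y" for X Y :: "'a set"
  by (auto simp: doubleton_eq_iff)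

lemma adjacent_cuts_disjoint:
  fixes P Q :: "'v :: card2 set"
  assumes "P \<noteq> {}" "Q \<noteq> {}" "P \<inter> Q = {}" "P \<union> Q \<noteq> UNIV"
  shows "adjacent_cuts {P, - P} {Q, - Q}"
proof -
  have cuts: "is_cut P" "is_cut Q" using assms by (auto simp: is_cut_def)
  have neq: "\<not> (P = Q \<or> P = - Q)" using assms by auto
  then have "cut_vector P \<noteq> cut_vector Q" by (simp add: cut_vector_eq_iff)
  moreover obtain c where "\<And>e. 0 < c $ e" "exactly_two_min_cuts c P Q"
    using exists_weights_exactly_two_min_cuts [OF assms] by blast
  ultimately have "aff_dim (min_cut_cone P \<inter> min_cut_cone Q) = int (CARD('v) choose 2) - 1"
    by (rule aff_dim_Int_min_cut_cones [OF cuts])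
  then show ?thesis using neq by (simp add: adjacent_cuts_def cone_of_cut cut_pair_eq_iff)
qed

subsection \<open>Crossing cuts\<close>

lemma min_cut_cones_vanish_between_differences:
  assumes c: "c \<in> min_cut_cone X \<inter> min_cut_cone Y"
    and "X \<inter> Y \<noteq> {}" "X \<union> Y \<noteq> UNIV" and e: "e \<in> edges_between (X - Y) (Y - X)"
  shows "c $ e = 0"
proof -
  let ?D = "edges_between (X - Y) (Y - X)"
  have nonneg: "0 \<le> c $ e" for e using c by (simp add: min_cut_cone_def)
  have "X \<noteq> {}" "Y \<noteq> UNIV" "X \<union> Y \<noteq> {}" "X \<inter> Y \<noteq> UNIV" using assms(2,3) by auto
  then have "is_cut (X \<inter> Y)" "is_cut (X \<union> Y)" using assms(2,3) by (simp_all add: is_cut_def)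
  then have "c \<bullet> cut_vector X + c \<bullet> cut_vector Y
      \<le> c \<bullet> cut_vector (X \<inter> Y) + c \<bullet> cut_vector (X \<union> Y)"
    using c by (intro add_mono min_cut_cone_inner_le) auto
  moreover have "c \<bullet> cut_vector X + c \<bullet> cut_vector Y
      = c \<bullet> cut_vector (X \<inter> Y) + c \<bullet> cut_vector (X \<union> Y) + 2 * (\<Sum>e\<in>?D. c $ e)"
    using arg_cong [OF cut_vector_add_eq_Int_Un [of X Y], of "(\<bullet>) c"]
    by (simp add: inner_add_right inner_incidence_vector)
  ultimately have "(\<Sum>e\<in>?D. c $ e) \<le> 0" by linarith
  moreover have "c $ e \<le> (\<Sum>e\<in>?D. c $ e)"
    using e nonneg by (intro member_le_sum) auto
  ultimately show ?thesis using nonneg [of e] by linarith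
qed

definition crossing :: "'a set set \<Rightarrow> 'a set set \<Rightarrow> bool" where
  "crossing C D \<longleftrightarrow> (\<forall>X\<in>C. \<forall>Y\<in>D. X \<inter> Y \<noteq> {})"

lemma crossing_cut_pairs_iff:
  "crossing {X, - X} {Y, - Y} \<longleftrightarrow> X \<inter> Y \<noteq> {} \<and> X - Y \<noteq> {} \<and> Y - X \<noteq> {} \<and> X \<union> Y \<noteq> UNIV"
  by (auto simp: crossing_def)

lemma cutsE:
  assumes "C \<in> cuts"
  obtains X where "C = {X, - X}" "is_cut X"
  using assms by (auto simp: cuts_def)

lemma is_cut_Compl: "is_cut (- X) \<longleftrightarrow> is_cut X"
  unfolding is_cut_def by blast

lemma cuts_memD:
  assumes "C \<in> cuts" "X \<in> C"
  shows "C = {X, - X}" "is_cut X"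
  using assms by (auto simp: cuts_def is_cut_Compl)

lemma not_crossing_self: "C \<in> cuts \<Longrightarrow> \<not> crossing C C"
  by (elim cutsE) (simp add: crossing_cut_pairs_iff)

lemma aff_dim_Int_min_cut_cones_crossing:
  fixes X Y :: "'v :: card2 set"
  assumes "X \<inter> Y \<noteq> {}" "X - Y \<noteq> {}" "Y - X \<noteq> {}" "X \<union> Y \<noteq> UNIV"
  shows "aff_dim (min_cut_cone X \<inter> min_cut_cone Y) \<le> int (CARD('v) choose 2) - 2"
proof -
  obtain e where e: "e \<in> edges_between (X - Y) (Y - X)"
    using assms edges_between_nonempty [of "X - Y" "Y - X"] by blast
  obtain f where f: "f \<in> edges_between (X \<inter> Y) (- (X \<union> Y))"
    using assms edges_between_nonempty [of "X \<inter> Y" "- (X \<union> Y)"] by blast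
  have "e \<noteq> f"
    using e f edges_between_disjoint [of "X - Y" "- (X \<union> Y)" "Y - X" "X \<inter> Y"] by blast
  have "c $ e = 0" "c $ f = 0" if "c \<in> min_cut_cone X \<inter> min_cut_cone Y" for c
    using min_cut_cones_vanish_between_differences [of c X Y e]
      min_cut_cones_vanish_between_differences [of c X "- Y" f] that assms e f
    by (auto simp: min_cut_cone_Compl Diff_eq Int_commute)
  then have "min_cut_cone X \<inter> min_cut_cone Y \<subseteq> {c. \<forall>i\<in>{e, f}. c $ i = 0}" by blast
  then have "aff_dim (min_cut_cone X \<inter> min_cut_cone Y)
      \<le> aff_dim {c :: real ^ 'v edge. \<forall>i\<in>{e, f}. c $ i = 0}"
    by (rule aff_dim_subset)
  also have "\<dots> = int (CARD('v) choose 2) - 2"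
    using \<open>e \<noteq> f\<close> by (simp only: aff_dim_coordinates_zero card_edge) simp
  finally show ?thesis .
qed

theorem adjacent_cuts_iff_not_crossing:
  assumes "C \<in> cuts" "D \<in> cuts"
  shows "adjacent_cuts C D \<longleftrightarrow> C \<noteq> D \<and> \<not> crossing C D"
proof (intro iffI conjI)
  assume adj: "adjacent_cuts C D"
  then show "C \<noteq> D" by (simp add: adjacent_cuts_def)
  obtain X Y where "C = {X, - X}" "D = {Y, - Y}" using assms by (metis cutsE)
  then show "\<not> crossing C D"
    using adj aff_dim_Int_min_cut_cones_crossing [of X Y]
    by (auto simp: crossing_cut_pairs_iff adjacent_cuts_def cone_of_cut)
next
  assume "C \<noteq> D \<and> \<not> crossing C D"
  then obtain P Q where PQ: "C \<noteq> D" "P \<in> C" "Q \<in> D" "P \<inter> Q = {}"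
    by (auto simp: crossing_def)
  have "C = {P, - P}" "is_cut P" "D = {Q, - Q}" "is_cut Q"
    using cuts_memD assms PQ(2,3) by metis+
  moreover from this PQ have "P \<union> Q \<noteq> UNIV" by (auto simp: cut_pair_eq_iff)
  ultimately show "adjacent_cuts C D"
    using adjacent_cuts_disjoint PQ(4) by (metis is_cut_def)
qed

lemma crossing_cuts_common_neighbour:
  assumes "C \<in> cuts" "D \<in> cuts" "crossing C D"
  obtains A where "A \<in> cuts" "adjacent_cuts C A" "adjacent_cuts A D"
proof -
  obtain X Y where XY: "C = {X, - X}" "D = {Y, - Y}" using assms by (metis cutsE)
  define A where "A = {X \<inter> Y, - (X \<inter> Y)}"
  have cross: "X \<inter> Y \<noteq> {}" "X - Y \<noteq> {}" "Y - X \<noteq> {}"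
    using assms(3) by (auto simp: XY crossing_cut_pairs_iff)
  then have "A \<in> cuts" unfolding A_def cuts_def is_cut_def by blast
  moreover have "C \<noteq> A" "A \<noteq> D"
    using cross by (auto simp: A_def XY cut_pair_eq_iff)
  moreover have "\<not> crossing C A" "\<not> crossing A D"
    unfolding A_def XY crossing_cut_pairs_iff by blast+
  ultimately show thesis
    using that assms(1,2) by (simp add: adjacent_cuts_iff_not_crossing)
qed

lemma exists_crossing_cuts:
  assumes "CARD('v :: card2) \<ge> 4"
  obtains C D :: "'v :: card2 set set" where "C \<in> cuts" "D \<in> cuts" "crossing C D"
proof -
  obtain S :: "'v set" where "card S = 4"
    using assms by (metis obtain_subset_with_card_n)
  then obtain a b c d :: 'v where "distinct [a, b, c, d]"
    by (auto simp: card_Suc_eq numeral_eq_Suc)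
  then have "{a, b} \<inter> {a, c} \<noteq> {}" "{a, b} - {a, c} \<noteq> {}" "{a, c} - {a, b} \<noteq> {}"
    "d \<notin> {a, b} \<union> {a, c}" by auto
  then have "crossing {{a, b}, - {a, b}} {{a, c}, - {a, c}}"
    unfolding crossing_cut_pairs_iff by blast
  moreover have "is_cut {a, b}" "is_cut {a, c}"
    using \<open>d \<notin> {a, b} \<union> {a, c}\<close> by (auto simp: is_cut_def)
  ultimately show thesis using that unfolding cuts_def by blast
qed

lemma cone_graph_dominates_iff:
  "C \<rightarrow>\<^bsub>cone_graph\<^esub> D \<longleftrightarrow> C \<in> cuts \<and> D \<in> cuts \<and> adjacent_cuts C D"
  by (auto simp: cone_graph_def arcs_ends_conv image_iff)

theorem theorem4:
  assumes "CARD('v :: card2) \<ge> 4"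
  shows "graph_diameter (cone_graph :: ('v set set, 'v set set \<times> 'v set set) pre_digraph) = 2"
proof -
  let ?G = "cone_graph :: ('v set set, 'v set set \<times> 'v set set) pre_digraph"
  interpret graph ?G by (rule graph_cone_graph)
  have verts: "verts ?G = cuts" by (simp add: cone_graph_def)
  obtain X Y :: "'v set set" where XY: "X \<in> cuts" "Y \<in> cuts" "crossing X Y"
    using assms by (rule exists_crossing_cuts)
  show ?thesis
  proof (rule antisym)
    show "graph_diameter ?G \<le> 2"
    proof (rule graph_diameter_le_2I, unfold verts cone_graph_dominates_iff)
      fix C D :: "'v set set"
      assume CD: "C \<in> cuts" "D \<in> cuts" "C \<noteq> D" "\<not> (C \<in> cuts \<and> D \<in> cuts \<and> adjacent_cuts C D)"
      then have "crossing C D" by (simp add: adjacent_cuts_iff_not_crossing)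
      with CD show "\<exists>A. (C \<in> cuts \<and> A \<in> cuts \<and> adjacent_cuts C A)
          \<and> (A \<in> cuts \<and> D \<in> cuts \<and> adjacent_cuts A D)"
        by (metis crossing_cuts_common_neighbour)
    qed
    show "2 \<le> graph_diameter ?G"
      using XY not_crossing_self
      by (intro graph_diameter_ge_2I [of X Y])
        (auto simp: verts cone_graph_dominates_iff adjacent_cuts_iff_not_crossing)
  qed
qed

end
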